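(* Let $c = \dfrac{\log(26/27)}{\log(3/4)}$ (so $c=0.131\dots$). For the family of all finite abelian groups, the threshold density for corners satisfies $$M(\alpha)\le\frac{27}{26}\,\alpha^{3+c}$$ for every $\alpha\in[0,1]$.
   Context: Corners and $S_d$: for a finite abelian group $G$ with $|G| = N$, a subset $A \subset G\times G$ and $d \in G$, let $S_d = \{(x,y) \in G\times G : (x,y),\,(x+d,y),\,(x,y+d) \in A\}$. The density of $A$ is $|A|/N^2$. Threshold density: for a family of finite abelian groups and $\alpha\in[0,1]$, $M(\alpha)$ is the largest $M \in [0,1]$ such that for every $\epsilon > 0$ there is an $N_0$ such that for all groups $G$ in the family with $|G| = N \ge N_0$ and all subsets $A \subset G\times G$ of density at least $\alpha$, there is a $d \in G\setminus\{0\}$ with $|S_d| > (M-\epsilon)N^2$. *)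

theory Defs
  imports Complex_Main "HOL-Algebra.Weak_Morphisms"
begin

text \<open>
  Abelian groups are HOL-Algebra commutative groups, written multiplicatively: \<open>x \<otimes> d\<close> stands
  for $x + d$ and \<open>\<one>\<close> for the neutral element $0$.
\<close>

definition corner_set :: "'a monoid \<Rightarrow> ('a \<times> 'a) set \<Rightarrow> 'a \<Rightarrow> ('a \<times> 'a) set" where
  "corner_set G A d =
     {(x, y) \<in> carrier G \<times> carrier G.
        (x, y) \<in> A \<and> (x \<otimes>\<^bsub>G\<^esub> d, y) \<in> A \<and> (x, y \<otimes>\<^bsub>G\<^esub> d) \<in> A}"

definition pair_density :: "'a monoid \<Rightarrow> ('a \<times> 'a) set \<Rightarrow> real" where
  "pair_density G A = real (card A) / real (order G) ^ 2"

definition popular_corner_bound :: "'a monoid set \<Rightarrow> real \<Rightarrow> real \<Rightarrow> bool" where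
  "popular_corner_bound F \<alpha> M \<longleftrightarrow>
     (\<forall>\<epsilon>>0. \<exists>N\<^sub>0. \<forall>G\<in>F. order G \<ge> N\<^sub>0 \<longrightarrow>
        (\<forall>A. A \<subseteq> carrier G \<times> carrier G \<and> pair_density G A \<ge> \<alpha> \<longrightarrow>
           (\<exists>d \<in> carrier G - {\<one>\<^bsub>G\<^esub>}.
              real (card (corner_set G A d)) > (M - \<epsilon>) * real (order G) ^ 2)))"

definition threshold_density :: "'a monoid set \<Rightarrow> real \<Rightarrow> real" where
  "threshold_density F \<alpha> = (GREATEST M. M \<in> {0..1} \<and> popular_corner_bound F \<alpha> M)"

text \<open>
  HOL sets are typed, so the family of all finite abelian groups is represented by those whose
  carrier is a set of natural numbers. By \<open>finite_abelian_group_on_nat\<close> below, every finite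
  abelian group is isomorphic to a member.
\<close>

definition finite_abelian_groups :: "nat monoid set" where
  "finite_abelian_groups = {G. comm_group G \<and> finite (carrier G)}"

lemma finite_abelian_group_on_nat:
  fixes G :: "('a, 'b) monoid_scheme"
  assumes "comm_group G" and fin: "finite (carrier G)"
  shows "\<exists>H \<in> finite_abelian_groups. G \<cong> H"
proof -
  interpret comm_group G by fact
  obtain f :: "'a \<Rightarrow> nat" where f: "inj_on f (carrier G)"
    using finite_imp_inj_to_nat_seg[OF fin] by blast
  define H where "H = image_group f G"
  have iso: "f \<in> iso G H"
    using f by (auto simp: H_def image_group_def iso_def hom_def bij_betw_def inv_into_f_f)
  have "comm_group (H \<lparr> one := f \<one>\<^bsub>G\<^esub> \<rparr>)"
    by (rule iso_imp_img_comm_group[OF iso])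
  then have "comm_group H"
    by (simp add: H_def image_group_def)
  moreover have "finite (carrier H)"
    using fin by (simp add: H_def image_group_def)
  ultimately show ?thesis
    using iso by (auto simp: finite_abelian_groups_def is_iso_def)
qed

text \<open>
  The maximum in \<open>threshold_density\<close> exists, so the \<open>GREATEST\<close> operator is never applied to an
  empty or unattained set.
\<close>

lemma threshold_density_greatest:
  fixes F :: "'a monoid set"
  assumes F: "\<And>G. G \<in> F \<Longrightarrow> group G \<and> finite (carrier G)"
  shows "threshold_density F \<alpha> \<in> {0..1}"
    and "popular_corner_bound F \<alpha> (threshold_density F \<alpha>)"
    and "\<And>M. M \<in> {0..1} \<Longrightarrow> popular_corner_bound F \<alpha> M \<Longrightarrow> M \<le> threshold_density F \<alpha>"
proof -
  define S where "S = {M. M \<in> {0..1} \<and> popular_corner_bound F \<alpha> M}"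
  have "popular_corner_bound F \<alpha> 0"
    unfolding popular_corner_bound_def
  proof (intro allI impI exI[of _ 2] ballI)
    fix \<epsilon> :: real and G A
    assume "\<epsilon> > 0" "G \<in> F" and ord: "2 \<le> order G"
    then have "finite (carrier G)" using F by blast
    have "carrier G - {\<one>\<^bsub>G\<^esub>} \<noteq> {}"
    proof
      assume "carrier G - {\<one>\<^bsub>G\<^esub>} = {}"
      then have "card (carrier G) \<le> card {\<one>\<^bsub>G\<^esub>}"
        by (intro card_mono) auto
      with ord show False by (simp add: order_def)
    qed
    then obtain d where "d \<in> carrier G - {\<one>\<^bsub>G\<^esub>}" by blast
    moreover have "(0 - \<epsilon>) * real (order G) ^ 2 < 0"
      using \<open>\<epsilon> > 0\<close> ord by (intro mult_neg_pos) auto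
    then have "(0 - \<epsilon>) * real (order G) ^ 2 < real (card (corner_set G A d))"
      by (rule less_le_trans) simp
    ultimately show "\<exists>d \<in> carrier G - {\<one>\<^bsub>G\<^esub>}.
        real (card (corner_set G A d)) > (0 - \<epsilon>) * real (order G) ^ 2" by blast
  qed
  then have "0 \<in> S" by (simp add: S_def)
  then have ne: "S \<noteq> {}" by blast
  have bdd: "bdd_above S" by (auto simp: S_def intro: bdd_aboveI[of _ 1])
  have "popular_corner_bound F \<alpha> (Sup S)"
    unfolding popular_corner_bound_def
  proof (intro allI impI)
    fix \<epsilon> :: real assume "\<epsilon> > 0"
    then have "Sup S - \<epsilon> / 2 < Sup S" by simp
    then obtain M where M: "M \<in> S" "Sup S - \<epsilon> / 2 < M"
      using less_cSup_iff[OF ne bdd] by blast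
    have "popular_corner_bound F \<alpha> M" and e2: "\<epsilon> / 2 > 0"
      using M \<open>\<epsilon> > 0\<close> by (auto simp: S_def)
    then obtain N\<^sub>0 where N: "\<forall>G\<in>F. order G \<ge> N\<^sub>0 \<longrightarrow>
        (\<forall>A. A \<subseteq> carrier G \<times> carrier G \<and> pair_density G A \<ge> \<alpha> \<longrightarrow>
           (\<exists>d \<in> carrier G - {\<one>\<^bsub>G\<^esub>}.
              real (card (corner_set G A d)) > (M - \<epsilon> / 2) * real (order G) ^ 2))"
      unfolding popular_corner_bound_def by blast
    have "(Sup S - \<epsilon>) * real n ^ 2 \<le> (M - \<epsilon> / 2) * real n ^ 2" for n
      using M by (intro mult_right_mono) auto
    then show "\<exists>N\<^sub>0. \<forall>G\<in>F. order G \<ge> N\<^sub>0 \<longrightarrow>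
        (\<forall>A. A \<subseteq> carrier G \<times> carrier G \<and> pair_density G A \<ge> \<alpha> \<longrightarrow>
           (\<exists>d \<in> carrier G - {\<one>\<^bsub>G\<^esub>}.
              real (card (corner_set G A d)) > (Sup S - \<epsilon>) * real (order G) ^ 2))"
      using N by (meson le_less_trans)
  qed
  moreover have "Sup S \<in> {0..1}"
  proof -
    obtain M where "M \<in> S" using ne by blast
    then have "0 \<le> Sup S"
      using cSup_upper[OF _ bdd] by (force simp: S_def)
    moreover have "Sup S \<le> 1"
      using ne by (intro cSup_least) (auto simp: S_def)
    ultimately show ?thesis by simp
  qed
  ultimately have mem: "Sup S \<in> {0..1} \<and> popular_corner_bound F \<alpha> (Sup S)" by simp
  have upper: "M \<le> Sup S" if "M \<in> {0..1} \<and> popular_corner_bound F \<alpha> M" for M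
    using that by (intro cSup_upper[OF _ bdd]) (simp add: S_def)
  have eq: "threshold_density F \<alpha> = Sup S"
    unfolding threshold_density_def using mem upper by (rule Greatest_equality)
  show "threshold_density F \<alpha> \<in> {0..1}" "popular_corner_bound F \<alpha> (threshold_density F \<alpha>)"
    using mem unfolding eq by blast+
  show "\<And>M. M \<in> {0..1} \<Longrightarrow> popular_corner_bound F \<alpha> M \<Longrightarrow> M \<le> threshold_density F \<alpha>"
    using upper unfolding eq by blast
qed

end

theory Submission
  imports Defs "HOL-Library.Nat_Bijection"
begin

text \<open>
  The threshold density promises a popular nonzero difference in every large finite abelian group,
  so an upper bound on it needs only one sequence of groups of unbounded order, each with a dense
  enough set that has few corners of every nonzero size. The groups
  are $\mathbb{F}_2^n$, realised as $\{0,\dots,2^n-1\}$ under bitwise exclusive or.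

  Fix a finite palette \<open>C\<close> and a set of admissible triples $E \subseteq C^3$ with indicator \<open>e\<close>,
  choose colourings \<open>X\<close>, \<open>Y\<close>, \<open>Z\<close> of the group and let \<open>A\<close> consist of the \<open>(x, y)\<close> for which
  $(X(x), Y(y), Z(x+y)) \in E$. The three points of a corner of size \<open>d\<close> then carry the triples
  \<open>(a, b, c)\<close>, \<open>(a', b, c')\<close>, \<open>(a, b', c')\<close>, where \<open>a, a'\<close> are the colours \<open>X\<close> gives to \<open>x\<close> and
  \<open>x + d\<close>, and similarly for \<open>b, b'\<close> and \<open>c, c'\<close>. If $d \neq 0$ and the colourings are random, these
  six colours are independent and uniform, so \<open>A\<close> should have density
  $p = \mathbb{E}\, e(a,b,c)$ and the proportion of corners of size \<open>d\<close> should be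
  $t = \mathbb{E}\, e(a,b,c)\,e(a',b,c')\,e(a,b',c')$. For fixed \<open>d\<close> the deviation from the expected
  value has exponentially small probability, which beats the union bound over the $2^n$ choices of
  \<open>d\<close>; \<open>exists_colouring\<close> and \<open>exists_three_colourings\<close> make this precise. In
  characteristic 2 this is easy because the pairs $\{z, z+d\}$ partition the group, so that a sum over
  \<open>z\<close> of terms depending on the colours of \<open>z\<close> and \<open>z + d\<close> splits into independent summands.

  It remains to find palettes for which \<open>t\<close> is small compared with $p^3$. With two colours and all
  triples admitted except the two constant ones, $p = 3/4$ and $t = 26/64 < 27/64 = p^3$. Taking products
  of palettes multiplies both numbers, which gives $p = (3/4)^k$ and $t = (26/64)^k = p^3 (26/27)^k$.
  For the densities in between, a further factor consists of the integers modulo \<open>m\<close> with \<open>(a, b, c)\<close>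
  admitted when $a + b + c$ falls into a fixed set of residues. All its two-dimensional
  marginals are constant, so it contributes factors $\beta$ and $\beta^3$, where $\beta$ is the proportion of
  these residues. Writing $\alpha = \beta (3/4)^k$ with $3/4 \le \beta < 1$ yields the value
  $\alpha^3 (26/27)^k$. Here $(26/27)^{k+1} = ((3/4)^{k+1})^c \le \alpha^c$ by the definition of \<open>c\<close>, and the
  constant $27/26$ pays for the one missing factor.
\<close>

section \<open>Averages over finite sets\<close>

definition mean :: "'a set \<Rightarrow> ('a \<Rightarrow> real) \<Rightarrow> real" where
  "mean S f = (\<Sum>x\<in>S. f x) / real (card S)"

lemma mean_cong: "(\<And>x. x \<in> S \<Longrightarrow> f x = g x) \<Longrightarrow> mean S f = mean S g"
  by (simp add: mean_def cong: sum.cong)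

lemma mean_const: "finite S \<Longrightarrow> S \<noteq> {} \<Longrightarrow> mean S (\<lambda>_. k) = k"
  by (simp add: mean_def)

lemma mean_mono: "(\<And>x. x \<in> S \<Longrightarrow> f x \<le> g x) \<Longrightarrow> mean S f \<le> mean S g"
  unfolding mean_def by (intro divide_right_mono sum_mono) auto

lemma mean_in_unit:
  assumes "finite S" "S \<noteq> {}" "\<And>x. x \<in> S \<Longrightarrow> f x \<in> {0..1}"
  shows "mean S f \<in> {0..1}"
  using mean_mono[of S "\<lambda>_. 0" f] mean_mono[of S f "\<lambda>_. 1"] assms
  by (auto simp: mean_const)

lemma mean_swap: "mean S (\<lambda>x. mean T (f x)) = mean T (\<lambda>y. mean S (\<lambda>x. f x y))"
  unfolding mean_def sum_divide_distrib[symmetric]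
  by (subst sum.swap) (simp add: mult.commute)

lemma mean_cmult: "mean S (\<lambda>x. k * f x) = k * mean S f"
  by (simp add: mean_def sum_distrib_left)

lemma mean_add: "mean S (\<lambda>x. f x + g x) = mean S f + mean S g"
  by (simp add: mean_def sum.distrib add_divide_distrib)

lemma mean_diff: "mean S (\<lambda>x. f x - g x) = mean S f - mean S g"
  by (simp add: mean_def sum_subtractf diff_divide_distrib)

lemma mean_pair_mult: "mean S (\<lambda>x. mean T (\<lambda>y. f x * g y)) = mean S f * mean T g"
  by (simp add: mean_def sum_product sum_divide_distrib[symmetric])

lemma mean_prod_encode:
  "mean (prod_encode ` (S \<times> T)) f = mean S (\<lambda>x. mean T (\<lambda>y. f (prod_encode (x, y))))"
  unfolding mean_def
  by (subst sum.reindex)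
     (auto simp: card_image inj_prod_encode card_cartesian_product sum.cartesian_product
       sum_divide_distrib[symmetric] mult.commute intro: inj_on_subset[OF inj_prod_encode])

section \<open>The elementary abelian 2-group on the natural numbers\<close>

definition xor_group :: "nat \<Rightarrow> nat monoid" where
  "xor_group n = \<lparr>carrier = {..<2 ^ n}, mult = xor, one = 0\<rparr>"

lemma xor_less: "x < 2 ^ n \<Longrightarrow> y < 2 ^ n \<Longrightarrow> xor x y < 2 ^ n" for x y :: nat
  by (metis take_bit_nat_eq_self_iff take_bit_xor)

lemma xor_cancel: "xor (xor x y) y = x" for x y :: nat
  by (simp add: xor.assoc)

lemma xor_ne: "d \<noteq> 0 \<Longrightarrow> xor x d \<noteq> x" for x d :: nat
  by (metis xor.assoc xor_self_eq xor.left_neutral)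

lemma xor_group_in_finite_abelian_groups: "xor_group n \<in> finite_abelian_groups"
proof -
  have "comm_group (xor_group n)"
  proof (rule comm_groupI)
    show "\<exists>y\<in>carrier (xor_group n). y \<otimes>\<^bsub>xor_group n\<^esub> x = \<one>\<^bsub>xor_group n\<^esub>"
      if "x \<in> carrier (xor_group n)" for x
      using that by (intro bexI[of _ x]) (auto simp: xor_group_def)
  qed (auto simp: xor_group_def xor_less ac_simps)
  then show ?thesis by (simp add: finite_abelian_groups_def xor_group_def)
qed

lemma mean_xor:
  assumes "d < 2 ^ n"
  shows "mean {..<2 ^ n} (\<lambda>x :: nat. f (xor x d)) = mean {..<2 ^ n} f"
  unfolding mean_def
  by (rule arg_cong[where f = "\<lambda>s. s / _"],
      rule sum.reindex_bij_witness[of _ "\<lambda>x. xor x d" "\<lambda>x. xor x d"])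
     (use assms in \<open>auto simp: xor_less xor_cancel\<close>)

section \<open>Random colourings\<close>

lemma exp_le_quadratic:
  fixes x :: real
  assumes "\<bar>x\<bar> \<le> 1"
  shows "exp x \<le> 1 + x + x\<^sup>2"
proof (cases "0 \<le> x")
  case True
  then show ?thesis using exp_bound[of x] assms by simp
next
  case False
  define y where "y = - x"
  have y: "0 \<le> y" "y \<le> 1" using False assms by (auto simp: y_def)
  have "1 \<le> (1 - y + y\<^sup>2) * (1 + y + y\<^sup>2 / 2)"
  proof -
    have "(1 - y + y\<^sup>2) * (1 + y + y\<^sup>2 / 2) = 1 + y^2/2 + y^3/2 + y^4/2"
      by (simp add: field_simps power2_eq_square power3_eq_cube power4_eq_xxxx)
    then show ?thesis using y by simp
  qed
  also have "\<dots> \<le> (1 - y + y\<^sup>2) * exp y"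
    using exp_lower_Taylor_quadratic[of y] y by (intro mult_left_mono) auto
  finally have "1 / exp y \<le> 1 - y + y\<^sup>2" by (simp add: field_simps)
  then show ?thesis by (simp add: y_def exp_minus divide_inverse)
qed

text \<open>
  A crude form of the inequality behind Hoeffding's lemma: for a bounded variable of mean zero the
  linear term averages out and only the square of the bound survives.
\<close>

lemma mean_exp_le:
  assumes "finite S" "S \<noteq> {}" "mean S f = 0" "\<And>x. x \<in> S \<Longrightarrow> \<bar>f x\<bar> \<le> b" "b \<le> 1"
  shows "mean S (\<lambda>x. exp (f x)) \<le> exp (b\<^sup>2)"
proof -
  have "exp (f x) \<le> f x - (- (1 + b\<^sup>2))" if "x \<in> S" for x
    using exp_le_quadratic[of "f x"] assms(4)[OF that] assms(5)
      power_mono[of "\<bar>f x\<bar>" b 2] by simp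
  then have "mean S (\<lambda>x. exp (f x)) \<le> mean S (\<lambda>x. f x - (- (1 + b\<^sup>2)))"
    by (rule mean_mono)
  also have "\<dots> = 1 + b\<^sup>2"
    unfolding mean_diff using assms by (simp add: mean_const)
  also have "\<dots> \<le> exp (b\<^sup>2)" by (rule exp_ge_add_one_self)
  finally show ?thesis .
qed

text \<open>
  \<open>R\<close> picks one element from each pair \<open>{z, xor z d}\<close>, so a uniformly random colouring of the whole
  group amounts to an independent uniform pair of colours for each element of \<open>R\<close>, and the
  expectation of a product over \<open>R\<close> factorises.
\<close>

lemma mean_prod_pairs:
  fixes h :: "nat \<Rightarrow> 'c \<Rightarrow> 'c \<Rightarrow> real"
  assumes d: "d \<noteq> 0" "d < 2 ^ n" and C: "finite C" "C \<noteq> {}"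
  defines "R \<equiv> {z \<in> {..<2 ^ n}. z < xor z d}"
  shows "mean (PiE {..<2 ^ n} (\<lambda>_. C)) (\<lambda>Z. \<Prod>z\<in>R. h z (Z z) (Z (xor z d)))
       = (\<Prod>z\<in>R. mean (C \<times> C) (\<lambda>(c, c'). h z c c'))"
proof -
  let ?V = "{..<2 ^ n} :: nat set"
  \<comment> \<open>\<open>j\<close> reads off the pairs of colours indexed by \<open>R\<close>, and \<open>i\<close> reassembles the colouring.\<close>
  define i where "i W = (\<lambda>z\<in>?V. if z \<in> R then fst (W z) else snd (W (xor z d)))" for W :: "nat \<Rightarrow> 'c \<times> 'c"
  define j where "j Z = (\<lambda>z\<in>R. (Z z, Z (xor z d)))" for Z :: "nat \<Rightarrow> 'c"
  have RV: "R \<subseteq> ?V" and finR: "finite R" by (auto simp: R_def)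
  have swap: "xor z d \<in> R" if "z < 2 ^ n" "z \<notin> R" for z
    using that d xor_ne[of d z] by (auto simp: R_def xor_less xor_cancel)
  have swap': "xor z d \<notin> R" if "z \<in> R" for z
    using that by (auto simp: R_def xor_cancel)
  have ij: "i W \<in> PiE ?V (\<lambda>_. C)" "j (i W) = W" if "W \<in> PiE R (\<lambda>_. C \<times> C)" for W
  proof -
    show "i W \<in> PiE ?V (\<lambda>_. C)"
      using that swap by (auto simp: i_def PiE_iff mem_Times_iff)
    show "j (i W) = W"
      using that swap' RV d
      by (intro ext) (auto simp: i_def j_def PiE_iff extensional_def xor_less xor_cancel subset_iff)
  qed
  have ji: "j Z \<in> PiE R (\<lambda>_. C \<times> C)" "i (j Z) = Z" if "Z \<in> PiE ?V (\<lambda>_. C)" for Z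
  proof -
    show "j Z \<in> PiE R (\<lambda>_. C \<times> C)"
      using that RV d by (auto simp: j_def PiE_iff xor_less subset_iff)
    show "i (j Z) = Z"
      using that swap by (intro ext) (auto simp: i_def j_def PiE_iff extensional_def xor_cancel)
  qed
  have bij: "bij_betw j (PiE ?V (\<lambda>_. C)) (PiE R (\<lambda>_. C \<times> C))"
  proof (rule bij_betw_byWitness[of _ i])
    show "\<forall>Z\<in>PiE ?V (\<lambda>_. C). i (j Z) = Z" by (intro ballI ji(2))
    show "\<forall>W\<in>PiE R (\<lambda>_. C \<times> C). j (i W) = W" by (intro ballI ij(2))
    show "j ` PiE ?V (\<lambda>_. C) \<subseteq> PiE R (\<lambda>_. C \<times> C)" by (intro image_subsetI ji(1))
    show "i ` PiE R (\<lambda>_. C \<times> C) \<subseteq> PiE ?V (\<lambda>_. C)" by (intro image_subsetI ij(1))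
  qed
  have "(\<Sum>Z\<in>PiE ?V (\<lambda>_. C). \<Prod>z\<in>R. h z (Z z) (Z (xor z d)))
      = (\<Sum>W\<in>PiE R (\<lambda>_. C \<times> C). \<Prod>z\<in>R. case W z of (c, c') \<Rightarrow> h z c c')"
    unfolding sum.reindex_bij_betw[OF bij, symmetric] by (simp add: j_def)
  also have "\<dots> = (\<Prod>z\<in>R. \<Sum>p\<in>C \<times> C. case p of (c, c') \<Rightarrow> h z c c')"
    using C finR by (subst prod_sum_PiE) auto
  finally have s: "(\<Sum>Z\<in>PiE ?V (\<lambda>_. C). \<Prod>z\<in>R. h z (Z z) (Z (xor z d)))
      = (\<Prod>z\<in>R. \<Sum>p\<in>C \<times> C. case p of (c, c') \<Rightarrow> h z c c')" .
  have "card (PiE ?V (\<lambda>_. C)) = (\<Prod>z\<in>R. card (C \<times> C))"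
    using bij_betw_same_card[OF bij] finR by (simp add: card_PiE)
  then show ?thesis
    unfolding mean_def s by (simp add: prod_dividef)
qed

lemma sum_pairs:
  fixes g :: "nat \<Rightarrow> real"
  assumes d: "d \<noteq> 0" "d < 2 ^ n"
  defines "R \<equiv> {z \<in> {..<2 ^ n}. z < xor z d}"
  shows "sum g {..<2 ^ n} = (\<Sum>z\<in>R. g z + g (xor z d))"
proof -
  let ?V = "{..<2 ^ n} :: nat set"
  have "sum g ?V = sum g R + sum g (?V - R)"
    by (subst sum.subset_diff[of R]) (auto simp: R_def)
  also have "sum g (?V - R) = (\<Sum>z\<in>R. g (xor z d))"
    by (rule sum.reindex_bij_witness[of _ "\<lambda>x. xor x d" "\<lambda>x. xor x d"])
       (use d in \<open>auto simp: R_def xor_less xor_cancel not_less le_less xor_ne\<close>)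
  finally show ?thesis by (simp add: sum.distrib)
qed

lemma mean_sum: "mean S (\<lambda>x. \<Sum>i\<in>I. f i x) = (\<Sum>i\<in>I. mean S (f i))"
  unfolding mean_def by (subst sum.swap) (simp add: sum_divide_distrib)

text \<open>
  A colouring can be chosen to satisfy, up to \<open>\<epsilon>\<close>, many constraints at once, as long as each
  constraint is a sum over \<open>z\<close> of terms depending only on the colours of \<open>z\<close> and \<open>xor z (\<delta> i)\<close>. For
  one constraint the deviation \<open>D\<close> from its expectation satisfies a Chernoff bound with parameter
  \<open>\<epsilon>/4\<close>: the exponential moment factorises over pairs. If every colouring violated some constraint,
  the sum of the exponential moments over all constraints would be too large.
\<close>

lemma exists_colouring:
  fixes K :: "'i \<Rightarrow> nat \<Rightarrow> 'c \<Rightarrow> 'c \<Rightarrow> real" and \<delta> :: "'i \<Rightarrow> nat"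
  assumes C: "finite C" "C \<noteq> {}" and finI: "finite I"
    and \<delta>: "\<And>i. i \<in> I \<Longrightarrow> \<delta> i \<in> {..<2 ^ n} - {0}"
    and K: "\<And>i z c c'. i \<in> I \<Longrightarrow> z < 2 ^ n \<Longrightarrow> c \<in> C \<Longrightarrow> c' \<in> C \<Longrightarrow> K i z c c' \<in> {0..1}"
    and \<epsilon>: "0 < \<epsilon>" "\<epsilon> \<le> 1"
    and many: "real (card I) * exp (- (\<epsilon>\<^sup>2 * 2 ^ n / 8)) < 1"
  shows "\<exists>Z \<in> {..<2 ^ n} \<rightarrow> C. \<forall>i\<in>I.
    mean {..<2 ^ n} (\<lambda>z. K i z (Z z) (Z (xor z (\<delta> i))))
      \<le> mean {..<2 ^ n} (\<lambda>z. mean C (\<lambda>c. mean C (\<lambda>c'. K i z c c'))) + \<epsilon>"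
proof (rule ccontr)
  let ?V = "{..<2 ^ n} :: nat set" and ?P = "PiE ({..<2 ^ n} :: nat set) (\<lambda>_. C)"
  define m where "m i z = mean C (\<lambda>c. mean C (\<lambda>c'. K i z c c'))" for i z
  define D where "D i Z = (\<Sum>z\<in>?V. K i z (Z z) (Z (xor z (\<delta> i))) - m i z)" for i Z
  have finP: "finite ?P" "?P \<noteq> {}"
    using C by (auto intro: finite_PiE simp: PiE_eq_empty_iff)
  assume "\<not> ?thesis"
  note none = this
  have bad: "\<exists>i\<in>I. mean ?V (\<lambda>z. K i z (Z z) (Z (xor z (\<delta> i)))) > mean ?V (m i) + \<epsilon>"
    if "Z \<in> ?P" for Z
  proof -
    have "Z \<in> ?V \<rightarrow> C" using that by (rule PiE_mem[THEN Pi_I])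
    then show ?thesis
      using none unfolding m_def not_le[symmetric] by blast
  qed
  have big: "1 \<le> (\<Sum>i\<in>I. exp (\<epsilon> / 4 * D i Z - \<epsilon>\<^sup>2 * 2 ^ n / 4))" if ZP: "Z \<in> ?P" for Z
  proof -
    obtain i where i: "i \<in> I" "mean ?V (\<lambda>z. K i z (Z z) (Z (xor z (\<delta> i)))) > mean ?V (m i) + \<epsilon>"
      using bad[OF ZP] by blast
    moreover have "D i Z = 2 ^ n * (mean ?V (\<lambda>z. K i z (Z z) (Z (xor z (\<delta> i)))) - mean ?V (m i))"
      unfolding D_def mean_diff[symmetric] by (simp add: mean_def)
    ultimately have "D i Z > \<epsilon> * 2 ^ n"
      by (simp add: mult.commute)
    then have "\<epsilon> / 4 * D i Z \<ge> \<epsilon> / 4 * (\<epsilon> * 2 ^ n)"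
      using \<epsilon> by (intro mult_left_mono) auto
    then have "1 \<le> exp (\<epsilon> / 4 * D i Z - \<epsilon>\<^sup>2 * 2 ^ n / 4)"
      by (simp add: power2_eq_square)
    also have "\<dots> \<le> (\<Sum>i\<in>I. exp (\<epsilon> / 4 * D i Z - \<epsilon>\<^sup>2 * 2 ^ n / 4))"
      using i finI by (intro member_le_sum) auto
    finally show ?thesis .
  qed
  have small: "mean ?P (\<lambda>Z. exp (\<epsilon> / 4 * D i Z)) \<le> exp (\<epsilon>\<^sup>2 * 2 ^ n / 8)" if i: "i \<in> I" for i
  proof -
    define R where "R = {z \<in> ?V. z < xor z (\<delta> i)}"
    \<comment> \<open>The contribution of the whole pair \<open>{z, xor z (\<delta> i)}\<close>; in its second half the two colours
      appear in the opposite order.\<close>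
    define L where "L z c c' = \<epsilon> / 4 * ((K i z c c' - m i z) + (K i (xor z (\<delta> i)) c' c - m i (xor z (\<delta> i))))"
      for z c c'
    have d: "\<delta> i \<noteq> 0" "\<delta> i < 2 ^ n" using \<delta>[OF i] by auto
    have RV: "z < 2 ^ n" "xor z (\<delta> i) < 2 ^ n" if "z \<in> R" for z
      using that d by (auto simp: R_def xor_less)
    have m01: "m i z \<in> {0..1}" if "z < 2 ^ n" for z
      unfolding m_def using C K[OF i that] by (intro mean_in_unit) auto
    have L0: "mean (C \<times> C) (\<lambda>(c, c'). L z c c') = 0" if "z \<in> R" for z
    proof -
      have "mean (C \<times> C) (\<lambda>(c, c'). L z c c') = mean C (\<lambda>c. mean C (\<lambda>c'. L z c c'))"
        by (simp add: mean_def sum.cartesian_product sum_divide_distrib[symmetric] card_cartesian_product)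
      also have "\<dots> = \<epsilon> / 4 * ((m i z - m i z)
          + (mean C (\<lambda>c. mean C (\<lambda>c'. K i (xor z (\<delta> i)) c' c)) - m i (xor z (\<delta> i))))"
        unfolding L_def mean_cmult
        using C by (simp add: mean_diff mean_add mean_const m_def)
      also have "mean C (\<lambda>c. mean C (\<lambda>c'. K i (xor z (\<delta> i)) c' c)) = m i (xor z (\<delta> i))"
        unfolding m_def by (rule mean_swap)
      finally show ?thesis by simp
    qed
    have Lb: "\<bar>L z c c'\<bar> \<le> \<epsilon> / 2" if "z \<in> R" "c \<in> C" "c' \<in> C" for z c c'
    proof -
      have "\<bar>(K i z c c' - m i z) + (K i (xor z (\<delta> i)) c' c - m i (xor z (\<delta> i)))\<bar> \<le> 2"
        using K[OF i RV(1)[OF that(1)] that(2,3)] K[OF i RV(2)[OF that(1)] that(3,2)]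
          m01[OF RV(1)[OF that(1)]] m01[OF RV(2)[OF that(1)]] by auto
      from mult_left_mono[OF this, of "\<epsilon> / 4"] \<epsilon> show ?thesis
        by (simp add: L_def abs_mult)
    qed
    have cardR: "2 * real (card R) = 2 ^ n"
      using sum_pairs[OF d, of "\<lambda>_. 1"] by (simp add: R_def)
    have "\<epsilon> / 4 * D i Z = (\<Sum>z\<in>R. L z (Z z) (Z (xor z (\<delta> i))))" for Z
      unfolding D_def sum_pairs[OF d] L_def R_def[symmetric]
      by (simp add: sum_distrib_left xor_cancel)
    then have "mean ?P (\<lambda>Z. exp (\<epsilon> / 4 * D i Z))
        = mean ?P (\<lambda>Z. \<Prod>z\<in>R. exp (L z (Z z) (Z (xor z (\<delta> i)))))"
      by (simp add: exp_sum R_def)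
    also have "\<dots> = (\<Prod>z\<in>R. mean (C \<times> C) (\<lambda>(c, c'). exp (L z c c')))"
      unfolding R_def by (rule mean_prod_pairs[OF d C])
    also have "\<dots> \<le> (\<Prod>z\<in>R. exp ((\<epsilon> / 2)\<^sup>2))"
    proof (rule prod_mono)
      fix z assume z: "z \<in> R"
      have "mean (C \<times> C) (\<lambda>p. exp (case p of (c, c') \<Rightarrow> L z c c')) \<le> exp ((\<epsilon> / 2)\<^sup>2)"
        using C z Lb L0 \<epsilon> by (intro mean_exp_le) auto
      then show "0 \<le> mean (C \<times> C) (\<lambda>(c, c'). exp (L z c c')) \<and>
          mean (C \<times> C) (\<lambda>(c, c'). exp (L z c c')) \<le> exp ((\<epsilon> / 2)\<^sup>2)"
        by (auto simp: mean_def split_beta intro!: divide_nonneg_nonneg sum_nonneg)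
    qed
    also have "\<dots> = exp (\<epsilon>\<^sup>2 * 2 ^ n / 8)"
      using cardR by (simp add: exp_of_nat_mult[symmetric] power2_eq_square field_simps)
    finally show ?thesis .
  qed
  have "1 = mean ?P (\<lambda>_. 1)" using finP by (simp add: mean_const)
  also have "\<dots> \<le> mean ?P (\<lambda>Z. \<Sum>i\<in>I. exp (\<epsilon> / 4 * D i Z - \<epsilon>\<^sup>2 * 2 ^ n / 4))"
    by (intro mean_mono big)
  also have "\<dots> = (\<Sum>i\<in>I. exp (- (\<epsilon>\<^sup>2 * 2 ^ n / 4)) * mean ?P (\<lambda>Z. exp (\<epsilon> / 4 * D i Z)))"
    unfolding mean_sum mean_cmult[symmetric] exp_add[symmetric] by (simp add: algebra_simps)
  also have "\<dots> \<le> (\<Sum>i\<in>I. exp (- (\<epsilon>\<^sup>2 * 2 ^ n / 4)) * exp (\<epsilon>\<^sup>2 * 2 ^ n / 8))"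
    by (intro sum_mono mult_left_mono small) auto
  also have "\<dots> = real (card I) * exp (- (\<epsilon>\<^sup>2 * 2 ^ n / 8))"
    unfolding exp_add[symmetric] by simp
  finally show False using many by simp
qed

abbreviation mean6 :: "'c set \<Rightarrow> ('c \<Rightarrow> 'c \<Rightarrow> 'c \<Rightarrow> 'c \<Rightarrow> 'c \<Rightarrow> 'c \<Rightarrow> real) \<Rightarrow> real" where
  "mean6 C \<Phi> \<equiv> mean C (\<lambda>a. mean C (\<lambda>a'. mean C (\<lambda>b. mean C (\<lambda>b'.
     mean C (\<lambda>c. mean C (\<lambda>c'. \<Phi> a a' b b' c c'))))))"

text \<open>
  The colourings are fixed one after the other: \<open>X\<close> is chosen for the weights averaged over the other
  four colours, then \<open>Y\<close> for the weights averaged over \<open>c\<close> and \<open>c'\<close> with \<open>X\<close> already known, then \<open>Z\<close>.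
  At each stage only one colouring is random, so the sum over pairs \<open>(x, y)\<close> is a constraint of the
  kind handled by \<open>exists_colouring\<close>, and each stage costs an error \<open>\<epsilon>\<close>.
\<close>

lemma exists_three_colourings:
  fixes \<Phi> :: "'j \<Rightarrow> 'c \<Rightarrow> 'c \<Rightarrow> 'c \<Rightarrow> 'c \<Rightarrow> 'c \<Rightarrow> 'c \<Rightarrow> real"
  assumes C: "finite C" "C \<noteq> {}" and J: "finite J"
    and \<Phi>: "\<And>j a a' b b' c c'. \<lbrakk>j \<in> J; a \<in> C; a' \<in> C; b \<in> C; b' \<in> C; c \<in> C; c' \<in> C\<rbrakk>
      \<Longrightarrow> \<Phi> j a a' b b' c c' \<in> {0..1}"
    and \<epsilon>: "0 < \<epsilon>" "\<epsilon> \<le> 1"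
    and many: "real (card J) * 2 ^ n * exp (- (\<epsilon>\<^sup>2 * 2 ^ n / 8)) < 1"
  shows "\<exists>X \<in> ({..<2 ^ n} :: nat set) \<rightarrow> C. \<exists>Y \<in> {..<2 ^ n} \<rightarrow> C. \<exists>Z \<in> {..<2 ^ n} \<rightarrow> C.
    \<forall>j\<in>J. \<forall>d\<in>{..<2 ^ n} - {0}.
      mean {..<2 ^ n} (\<lambda>x. mean {..<2 ^ n} (\<lambda>y.
        \<Phi> j (X x) (X (xor x d)) (Y y) (Y (xor y d)) (Z (xor x y)) (Z (xor (xor x y) d))))
      \<le> mean6 C (\<Phi> j) + 3 * \<epsilon>"
proof -
  let ?V = "{..<2 ^ n} :: nat set"
  define I where "I = J \<times> (?V - {0})"
  have V: "finite ?V" "?V \<noteq> {}" by (auto simp: lessThan_empty_iff)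
  have finI: "finite I" using J by (simp add: I_def)
  have "real (card I) \<le> real (card J) * 2 ^ n"
    by (simp add: I_def card_cartesian_product mult_left_mono)
  then have "real (card I) * exp (- (\<epsilon>\<^sup>2 * 2 ^ n / 8)) \<le> real (card J) * 2 ^ n * exp (- (\<epsilon>\<^sup>2 * 2 ^ n / 8))"
    by (rule mult_right_mono) simp
  then have card_I: "real (card I) * exp (- (\<epsilon>\<^sup>2 * 2 ^ n / 8)) < 1"
    using many by linarith
  define \<Phi>Z where "\<Phi>Z j a a' b b' = mean C (\<lambda>c. mean C (\<lambda>c'. \<Phi> j a a' b b' c c'))" for j a a' b b'
  define \<Phi>Y where "\<Phi>Y j a a' = mean C (\<lambda>b. mean C (\<lambda>b'. \<Phi>Z j a a' b b'))" for j a a'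
  have \<Phi>Z: "\<Phi>Z j a a' b b' \<in> {0..1}" if "j \<in> J" "a \<in> C" "a' \<in> C" "b \<in> C" "b' \<in> C" for j a a' b b'
    unfolding \<Phi>Z_def using C that \<Phi> by (intro mean_in_unit) blast+
  have \<Phi>Y: "\<Phi>Y j a a' \<in> {0..1}" if "j \<in> J" "a \<in> C" "a' \<in> C" for j a a'
    unfolding \<Phi>Y_def using C that \<Phi>Z by (intro mean_in_unit) blast+
  note col = exists_colouring[OF C finI _ _ \<epsilon> card_I, where \<delta> = snd]
  have "\<exists>X \<in> ?V \<rightarrow> C. \<forall>i\<in>I. mean ?V (\<lambda>x. \<Phi>Y (fst i) (X x) (X (xor x (snd i))))
      \<le> mean ?V (\<lambda>x. mean C (\<lambda>a. mean C (\<lambda>a'. \<Phi>Y (fst i) a a'))) + \<epsilon>"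
    using \<Phi>Y by (intro col) (auto simp: I_def)
  then obtain X where X: "X \<in> ?V \<rightarrow> C"
    and X1: "\<And>j d. j \<in> J \<Longrightarrow> d \<in> ?V - {0} \<Longrightarrow> mean ?V (\<lambda>x. \<Phi>Y j (X x) (X (xor x d)))
      \<le> mean C (\<lambda>a. mean C (\<lambda>a'. \<Phi>Y j a a')) + \<epsilon>"
    by (auto simp: I_def mean_const V)
  have Xd: "X x \<in> C" "X (xor x d) \<in> C" if "x < 2 ^ n" "d < 2 ^ n" for x d
    using X that by (auto simp: xor_less Pi_iff)
  have "\<exists>Y \<in> ?V \<rightarrow> C. \<forall>i\<in>I.
      mean ?V (\<lambda>y. mean ?V (\<lambda>x. \<Phi>Z (fst i) (X x) (X (xor x (snd i))) (Y y) (Y (xor y (snd i)))))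
      \<le> mean ?V (\<lambda>y. mean C (\<lambda>b. mean C (\<lambda>b'.
          mean ?V (\<lambda>x. \<Phi>Z (fst i) (X x) (X (xor x (snd i))) b b')))) + \<epsilon>"
    using \<Phi>Z Xd V by (intro col mean_in_unit) (auto simp: I_def)
  then obtain Y where Y: "Y \<in> ?V \<rightarrow> C"
    and Y1: "\<And>j d. j \<in> J \<Longrightarrow> d \<in> ?V - {0} \<Longrightarrow>
      mean ?V (\<lambda>y. mean ?V (\<lambda>x. \<Phi>Z j (X x) (X (xor x d)) (Y y) (Y (xor y d))))
      \<le> mean C (\<lambda>b. mean C (\<lambda>b'. mean ?V (\<lambda>x. \<Phi>Z j (X x) (X (xor x d)) b b'))) + \<epsilon>"
    by (auto simp: I_def mean_const V)
  have Yd: "Y x \<in> C" "Y (xor x d) \<in> C" if "x < 2 ^ n" "d < 2 ^ n" for x d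
    using Y that by (auto simp: xor_less Pi_iff)
  \<comment> \<open>For fixed \<open>z = xor x y\<close> the point \<open>y\<close> is recovered as \<open>xor z x\<close>.\<close>
  have "\<exists>Z \<in> ?V \<rightarrow> C. \<forall>i\<in>I.
      mean ?V (\<lambda>z. mean ?V (\<lambda>x. \<Phi> (fst i) (X x) (X (xor x (snd i)))
         (Y (xor z x)) (Y (xor (xor z x) (snd i))) (Z z) (Z (xor z (snd i)))))
      \<le> mean ?V (\<lambda>z. mean C (\<lambda>c. mean C (\<lambda>c'.
          mean ?V (\<lambda>x. \<Phi> (fst i) (X x) (X (xor x (snd i)))
            (Y (xor z x)) (Y (xor (xor z x) (snd i))) c c')))) + \<epsilon>"
    using \<Phi> Xd Yd V by (intro col mean_in_unit) (auto simp: I_def xor_less)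
  then obtain Z where Z: "Z \<in> ?V \<rightarrow> C"
    and Z1: "\<And>j d. j \<in> J \<Longrightarrow> d \<in> ?V - {0} \<Longrightarrow>
      mean ?V (\<lambda>z. mean ?V (\<lambda>x. \<Phi> j (X x) (X (xor x d))
         (Y (xor z x)) (Y (xor (xor z x) d)) (Z z) (Z (xor z d))))
      \<le> mean ?V (\<lambda>z. mean C (\<lambda>c. mean C (\<lambda>c'.
          mean ?V (\<lambda>x. \<Phi> j (X x) (X (xor x d))
            (Y (xor z x)) (Y (xor (xor z x) d)) c c')))) + \<epsilon>"
    by (auto simp: I_def)
  have "mean ?V (\<lambda>x. mean ?V (\<lambda>y.
        \<Phi> j (X x) (X (xor x d)) (Y y) (Y (xor y d)) (Z (xor x y)) (Z (xor (xor x y) d))))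
      \<le> mean6 C (\<Phi> j) + 3 * \<epsilon>" if jd: "j \<in> J" "d \<in> ?V - {0}" for j d
  proof -
    have "mean ?V (\<lambda>x. mean ?V (\<lambda>y.
        \<Phi> j (X x) (X (xor x d)) (Y y) (Y (xor y d)) (Z (xor x y)) (Z (xor (xor x y) d))))
      = mean ?V (\<lambda>x. mean ?V (\<lambda>z.
        \<Phi> j (X x) (X (xor x d)) (Y (xor z x)) (Y (xor (xor z x) d)) (Z z) (Z (xor z d))))"
    proof (rule mean_cong)
      fix x assume "x \<in> ?V"
      then have x: "x < 2 ^ n" by simp
      show "mean ?V (\<lambda>y. \<Phi> j (X x) (X (xor x d)) (Y y) (Y (xor y d)) (Z (xor x y)) (Z (xor (xor x y) d)))
        = mean ?V (\<lambda>z. \<Phi> j (X x) (X (xor x d)) (Y (xor z x)) (Y (xor (xor z x) d)) (Z z) (Z (xor z d)))"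
        using mean_xor[OF x, of "\<lambda>z. \<Phi> j (X x) (X (xor x d)) (Y (xor z x)) (Y (xor (xor z x) d))
          (Z z) (Z (xor z d))"]
        by (simp only: xor_cancel xor.commute[of x])
    qed
    also have "\<dots> \<le> mean ?V (\<lambda>z. mean C (\<lambda>c. mean C (\<lambda>c'.
          mean ?V (\<lambda>x. \<Phi> j (X x) (X (xor x d)) (Y (xor z x)) (Y (xor (xor z x) d)) c c')))) + \<epsilon>"
      by (subst mean_swap) (rule Z1[OF jd])
    also have "mean ?V (\<lambda>z. mean C (\<lambda>c. mean C (\<lambda>c'.
          mean ?V (\<lambda>x. \<Phi> j (X x) (X (xor x d)) (Y (xor z x)) (Y (xor (xor z x) d)) c c'))))
      = mean ?V (\<lambda>z. mean ?V (\<lambda>x. \<Phi>Z j (X x) (X (xor x d)) (Y (xor z x)) (Y (xor (xor z x) d))))"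
      unfolding \<Phi>Z_def by (simp only: mean_swap[of C ?V])
    also have "\<dots> = mean ?V (\<lambda>x. mean ?V (\<lambda>z. \<Phi>Z j (X x) (X (xor x d)) (Y (xor z x)) (Y (xor (xor z x) d))))"
      by (rule mean_swap)
    also have "\<dots> = mean ?V (\<lambda>x. mean ?V (\<lambda>y. \<Phi>Z j (X x) (X (xor x d)) (Y y) (Y (xor y d))))"
      by (intro mean_cong mean_xor) simp
    also have "\<dots> = mean ?V (\<lambda>y. mean ?V (\<lambda>x. \<Phi>Z j (X x) (X (xor x d)) (Y y) (Y (xor y d))))"
      by (rule mean_swap)
    also have "\<dots> \<le> mean C (\<lambda>b. mean C (\<lambda>b'. mean ?V (\<lambda>x. \<Phi>Z j (X x) (X (xor x d)) b b'))) + \<epsilon>"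
      by (rule Y1[OF jd])
    also have "mean C (\<lambda>b. mean C (\<lambda>b'. mean ?V (\<lambda>x. \<Phi>Z j (X x) (X (xor x d)) b b')))
      = mean ?V (\<lambda>x. \<Phi>Y j (X x) (X (xor x d)))"
      unfolding \<Phi>Y_def by (simp only: mean_swap[of C ?V])
    also have "\<dots> \<le> mean C (\<lambda>a. mean C (\<lambda>a'. \<Phi>Y j a a')) + \<epsilon>"
      by (rule X1[OF jd])
    finally show ?thesis unfolding \<Phi>Y_def \<Phi>Z_def by simp
  qed
  then show ?thesis using X Y Z by blast
qed

section \<open>Colour models\<close>

definition corner_weight :: "('c \<Rightarrow> 'c \<Rightarrow> 'c \<Rightarrow> real) \<Rightarrow> 'c \<Rightarrow> 'c \<Rightarrow> 'c \<Rightarrow> 'c \<Rightarrow> 'c \<Rightarrow> 'c \<Rightarrow> real" where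
  "corner_weight e a a' b b' c c' = e a b c * e a' b c' * e a b' c'"

text \<open>
  The palette consists of natural numbers, so that \<open>prod_encode\<close> turns a product of two palettes into
  a palette again.
\<close>

definition colour_model :: "real \<Rightarrow> real \<Rightarrow> bool" where
  "colour_model p t \<longleftrightarrow> (\<exists>(C :: nat set) e. finite C \<and> C \<noteq> {} \<and> (\<forall>a b c. e a b c \<in> {0, 1})
     \<and> mean C (\<lambda>a. mean C (\<lambda>b. mean C (\<lambda>c. e a b c))) = p \<and> mean6 C (corner_weight e) = t)"

lemma colour_modelE:
  assumes "colour_model p t"
  obtains C :: "nat set" and e where "finite C" "C \<noteq> {}" "\<forall>a b c. e a b c \<in> {0, 1}"
    "mean C (\<lambda>a. mean C (\<lambda>b. mean C (\<lambda>c. e a b c))) = p" "mean6 C (corner_weight e) = t"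
proof -
  from assms obtain C where "\<exists>e. finite (C :: nat set) \<and> C \<noteq> {} \<and> (\<forall>a b c. e a b c \<in> {0, 1})
     \<and> mean C (\<lambda>a. mean C (\<lambda>b. mean C (\<lambda>c. e a b c))) = p \<and> mean6 C (corner_weight e) = t"
    unfolding colour_model_def by (rule exE)
  then obtain e where e: "finite C \<and> C \<noteq> {} \<and> (\<forall>a b c. e a b c \<in> {0, 1})
     \<and> mean C (\<lambda>a. mean C (\<lambda>b. mean C (\<lambda>c. e a b c))) = p \<and> mean6 C (corner_weight e) = t"
    by (rule exE)
  show thesis
    by (rule that[of C e]) (use e in simp_all)
qed

text \<open>
  On a product palette the colours split into two independent parts, and both the indicator and the
  corner weight factorise accordingly.
\<close>

lemma colour_model_mult:
  assumes "colour_model p t" "colour_model p' t'"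
  shows "colour_model (p * p') (t * t')"
proof -
  obtain C e where C: "finite (C :: nat set)" "C \<noteq> {}" "\<forall>a b c. e a b c \<in> {0, 1}"
    "mean C (\<lambda>a. mean C (\<lambda>b. mean C (\<lambda>c. e a b c))) = p" "mean6 C (corner_weight e) = t"
    using assms(1) by (rule colour_modelE) (rule that)
  obtain C' e' where C': "finite (C' :: nat set)" "C' \<noteq> {}" "\<forall>a b c. e' a b c \<in> {0, 1}"
    "mean C' (\<lambda>a. mean C' (\<lambda>b. mean C' (\<lambda>c. e' a b c))) = p'" "mean6 C' (corner_weight e') = t'"
    using assms(2) by (rule colour_modelE) (rule that)
  let ?l = "\<lambda>x. fst (prod_decode x)" and ?r = "\<lambda>x. snd (prod_decode x)"
  define f where "f a b c = e (?l a) (?l b) (?l c) * e' (?r a) (?r b) (?r c)" for a b c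
  have f: "corner_weight f a a' b b' c c' =
      corner_weight e (?l a) (?l a') (?l b) (?l b') (?l c) (?l c')
    * corner_weight e' (?r a) (?r a') (?r b) (?r b') (?r c) (?r c')" for a a' b b' c c'
    by (simp add: corner_weight_def f_def mult_ac)
  let ?D = "prod_encode ` (C \<times> C')"
  have "mean ?D (\<lambda>a. mean ?D (\<lambda>b. mean ?D (\<lambda>c. f a b c))) = p * p'"
    unfolding mean_prod_encode f_def prod_encode_inverse fst_conv snd_conv mean_pair_mult C C' ..
  moreover have "mean6 ?D (corner_weight f) = t * t'"
    unfolding mean_prod_encode f prod_encode_inverse fst_conv snd_conv mean_pair_mult C C' ..
  moreover have "f a b c \<in> {0, 1}" for a b c
    using C(3)[rule_format, of "?l a" "?l b" "?l c"] C'(3)[rule_format, of "?r a" "?r b" "?r c"] by (auto simp: f_def)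
  ultimately show ?thesis
    unfolding colour_model_def using C(1,2) C'(1,2)
    by (intro exI[of _ ?D] exI[of _ f]) auto
qed

text \<open>
  The gain over the value $(3/4)^3 = 27/64$ of a random set of the same density comes from the
  admissible fractions given two colours, which are $1/2$ if these are equal and \<open>1\<close> otherwise. Of the
  eight triples \<open>(a, b, c')\<close> of shared colours, the two constant ones have weight $1/8$. In each of
  the other six exactly two colours agree, which gives weight $1/2$.
\<close>

lemma colour_model_not_all_equal: "colour_model (3/4) (26/64)"
  unfolding colour_model_def
  by (rule exI[of _ "{0, 1}"], rule exI[of _ "\<lambda>a b c. of_bool (\<not> (a = b \<and> b = c))"])
     (simp add: mean_def corner_weight_def)

lemma colour_model_one: "colour_model 1 1"
  unfolding colour_model_def
  by (rule exI[of _ "{0}"], rule exI[of _ "\<lambda>a b c. 1"]) (simp add: mean_def corner_weight_def)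

lemma colour_model_power: "colour_model p t \<Longrightarrow> colour_model (p ^ k) (t ^ k)"
  by (induction k) (auto intro: colour_model_one colour_model_mult)

lemma card_shift_mod:
  assumes "0 < m" "l \<le> m"
  shows "card {c \<in> {..<m}. (s + c) mod m < l} = l"
proof -
  have "inj_on (\<lambda>c. (s + c) mod m) {..<m}"
  proof (rule inj_onI)
    fix x y assume xy: "x \<in> {..<m}" "y \<in> {..<m}" "(s + x) mod m = (s + y) mod m"
    then have "int (s + x) mod int m = int (s + y) mod int m"
      by (metis zmod_int)
    then have "int m dvd int x - int y"
      by (simp add: mod_eq_dvd_iff)
    then show "x = y"
      using xy zdvd_imp_le[of "int m" "int x - int y"] zdvd_imp_le[of "int m" "int y - int x"]
      by (cases x y rule: linorder_cases) (auto simp: dvd_diff_commute)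
  qed
  moreover from this have "(\<lambda>c. (s + c) mod m) ` {..<m} = {..<m}"
    using assms by (intro endo_inj_surj) auto
  ultimately have "bij_betw (\<lambda>c. (s + c) mod m) {..<m} {..<m}"
    by (simp add: bij_betw_def)
  then have "bij_betw (\<lambda>c. (s + c) mod m) {c \<in> {..<m}. (s + c) mod m < l} {c \<in> {..<m}. c < l}"
    unfolding bij_betw_def by (auto intro: inj_on_subset)
  then have "card {c \<in> {..<m}. (s + c) mod m < l} = card {c \<in> {..<m}. c < l}"
    by (rule bij_betw_same_card)
  also have "{c \<in> {..<m}. c < l} = {..<l}" using assms by auto
  finally show ?thesis by simp
qed

text \<open>
  For any two given colours, the proportion of third colours completing an admissible triple is
  \<open>l / m\<close>. In the corner weight each of \<open>c\<close>, \<open>b'\<close> and \<open>a'\<close> occurs in one factor only, and averaging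
  over them in this order leaves the cube.
\<close>

lemma colour_model_mod:
  assumes "0 < m" "l \<le> m"
  shows "colour_model (real l / real m) ((real l / real m) ^ 3)"
proof -
  let ?C = "{..<m}"
  define \<beta> where "\<beta> = real l / real m"
  define e :: "nat \<Rightarrow> nat \<Rightarrow> nat \<Rightarrow> real" where "e a b c = of_bool ((a + b + c) mod m < l)" for a b c
  have C: "finite ?C" "?C \<noteq> {}" using assms by (auto simp: lessThan_empty_iff)
  have shift: "mean ?C (\<lambda>c. of_bool ((s + c) mod m < l)) = \<beta>" for s
    using card_shift_mod[OF assms, of s] by (simp add: mean_def \<beta>_def Int_def)
  have ec: "mean ?C (\<lambda>c. e a b c) = \<beta>" for a b
    unfolding e_def by (rule shift)
  have eb: "mean ?C (\<lambda>b. e a b c) = \<beta>" for a c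
    using shift[of "a + c"] by (simp add: e_def ac_simps)
  have "mean ?C (\<lambda>b'. mean ?C (\<lambda>c. mean ?C (\<lambda>c'. corner_weight e a a' b b' c c'))) = \<beta> ^ 3"
    for a a' b
  proof -
    have "mean ?C (\<lambda>b'. mean ?C (\<lambda>c. mean ?C (\<lambda>c'. corner_weight e a a' b b' c c')))
      = mean ?C (\<lambda>b'. \<beta> * mean ?C (\<lambda>c'. e a' b c' * e a b' c'))"
      unfolding corner_weight_def mult.assoc mean_pair_mult ec ..
    also have "\<dots> = \<beta> * mean ?C (\<lambda>c'. mean ?C (\<lambda>b'. e a' b c' * e a b' c'))"
      by (simp only: mean_cmult[of ?C \<beta>] mean_swap[of ?C ?C "\<lambda>b' c'. e a' b c' * e a b' c'"])
    also have "\<dots> = \<beta> * mean ?C (\<lambda>c'. \<beta> * e a' b c')"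
      unfolding mean_cmult eb by (simp only: mult.commute[of _ \<beta>] mean_cmult)
    also have "\<dots> = \<beta> ^ 3"
      unfolding mean_cmult ec by (simp add: power3_eq_cube)
    finally show ?thesis .
  qed
  then have "mean6 ?C (corner_weight e) = \<beta> ^ 3"
    using C by (simp add: mean_const)
  moreover have "mean ?C (\<lambda>a. mean ?C (\<lambda>b. mean ?C (\<lambda>c. e a b c))) = \<beta>"
    unfolding ec using C by (simp add: mean_const)
  moreover have "\<forall>a b c. e a b c \<in> {0, 1}" by (simp add: e_def)
  ultimately show ?thesis
    unfolding colour_model_def \<beta>_def[symmetric] using C
    by (intro exI[of _ ?C] exI[of _ e] conjI)
qed

section \<open>From colour models to sets with few corners\<close>

lemma card_eq_mean:
  fixes P :: "nat \<Rightarrow> nat \<Rightarrow> bool"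
  shows "real (card {(x, y) \<in> {..<2 ^ n} \<times> {..<2 ^ n}. P x y}) =
    (2 ^ n)\<^sup>2 * mean {..<2 ^ n} (\<lambda>x. mean {..<2 ^ n} (\<lambda>y. of_bool (P x y)))"
proof -
  let ?V = "{..<2 ^ n} :: nat set"
  have "real (card {(x, y) \<in> ?V \<times> ?V. P x y}) = (\<Sum>p\<in>?V \<times> ?V. of_bool (P (fst p) (snd p)))"
    by (simp add: Int_def case_prod_unfold mem_Times_iff)
  also have "\<dots> = (\<Sum>x\<in>?V. \<Sum>y\<in>?V. of_bool (P x y))"
    unfolding sum.cartesian_product by (simp only: case_prod_unfold)
  finally show ?thesis
    by (simp add: mean_def sum_divide_distrib[symmetric] power2_eq_square)
qed

lemma ex_large_power_of_two:
  fixes c :: real and N :: nat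
  assumes "0 < c"
  shows "\<exists>n. 1 \<le> n \<and> N \<le> 2 ^ n \<and> 2 * 2 ^ n * exp (- (c * 2 ^ n)) < 1"
proof -
  obtain n where n: "max N (nat \<lceil>4 / c\<^sup>2\<rceil>) < n" by blast
  have "n < 2 ^ n" by (rule less_exp)
  then have "real n < 2 ^ n" by (metis of_nat_less_iff of_nat_numeral of_nat_power)
  moreover have "4 / c\<^sup>2 < real n" using n by linarith
  ultimately have big: "4 / c\<^sup>2 < 2 ^ n" by linarith
  define x :: real where "x = 2 ^ n"
  have x: "4 < c\<^sup>2 * x" "0 < x" using big assms by (simp_all add: x_def field_simps)
  have "4 * x < c\<^sup>2 * x * x" using x by (intro mult_strict_right_mono)
  then have "2 * x < (c * x)\<^sup>2 / 2" by (simp add: power2_eq_square mult_ac)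
  also have "\<dots> \<le> exp (c * x)"
    using exp_lower_Taylor_quadratic[of "c * x"] mult_pos_pos[OF assms x(2)] by linarith
  finally have "2 * x * exp (- (c * x)) < 1"
    by (simp add: exp_minus divide_inverse[symmetric])
  then show ?thesis
    using n less_trans[OF _ \<open>n < 2 ^ n\<close>, of N] by (intro exI[of _ n]) (simp add: x_def)
qed

text \<open>
  The strict inequalities leave room for the errors of the random colourings. The density of the set
  and its corners are controlled by the same colourings: the density enters as a second family of
  weights \<open>1 - e a b c\<close>, the proportion of missing pairs, which is bounded from above.
\<close>

lemma not_popular_corner_bound_colour_model:
  assumes "colour_model p t" "\<alpha> < p" "t < M"
  shows "\<not> popular_corner_bound finite_abelian_groups \<alpha> M"
proof
  assume pop: "popular_corner_bound finite_abelian_groups \<alpha> M"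
  obtain C e where C: "finite (C :: nat set)" "C \<noteq> {}" and e0: "\<forall>a b c. e a b c \<in> {0, 1}"
    and p: "mean C (\<lambda>a. mean C (\<lambda>b. mean C (\<lambda>c. e a b c))) = p" and t: "mean6 C (corner_weight e) = t"
    using assms(1) by (rule colour_modelE) (rule that)
  note e = e0[rule_format]
  define \<epsilon> where "\<epsilon> = min 1 (min (p - \<alpha>) ((M - t) / 2) / 3)"
  have \<epsilon>: "0 < \<epsilon>" "\<epsilon> \<le> 1" "3 * \<epsilon> \<le> p - \<alpha>" "3 * \<epsilon> \<le> (M - t) / 2"
    using assms(2,3) by (auto simp: \<epsilon>_def min_def)
  have "0 < (M - t) / 2" using assms(3) by simp
  with pop obtain N where "\<forall>G\<in>finite_abelian_groups. order G \<ge> N \<longrightarrow>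
      (\<forall>A. A \<subseteq> carrier G \<times> carrier G \<and> pair_density G A \<ge> \<alpha> \<longrightarrow>
        (\<exists>d \<in> carrier G - {\<one>\<^bsub>G\<^esub>}.
          real (card (corner_set G A d)) > (M - (M - t) / 2) * real (order G) ^ 2))"
    unfolding popular_corner_bound_def by meson
  note N = this[rule_format, OF _ _ conjI]
  obtain n where n: "1 \<le> n" "N \<le> 2 ^ n" "2 * 2 ^ n * exp (- (\<epsilon>\<^sup>2 / 8 * 2 ^ n)) < 1"
    using ex_large_power_of_two[of "\<epsilon>\<^sup>2 / 8" N] \<epsilon> by auto
  let ?V = "{..<2 ^ n} :: nat set"
  define \<Phi> where "\<Phi> j a a' b b' c c' = (if j then corner_weight e a a' b b' c c' else 1 - e a b c)"
    for j a a' b b' c c'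
  have "\<Phi> j a a' b b' c c' \<in> {0..1}" for j a a' b b' c c'
    using e[of a b c] e[of a' b c'] e[of a b' c'] by (auto simp: \<Phi>_def corner_weight_def)
  then have "\<exists>X \<in> ?V \<rightarrow> C. \<exists>Y \<in> ?V \<rightarrow> C. \<exists>Z \<in> ?V \<rightarrow> C. \<forall>j\<in>UNIV. \<forall>d\<in>?V - {0}.
      mean ?V (\<lambda>x. mean ?V (\<lambda>y.
        \<Phi> j (X x) (X (xor x d)) (Y y) (Y (xor y d)) (Z (xor x y)) (Z (xor (xor x y) d))))
      \<le> mean6 C (\<Phi> j) + 3 * \<epsilon>"
    using n(3) by (intro exists_three_colourings[OF C _ _ \<epsilon>(1,2)]) simp_all
  then obtain X Y Z where "\<forall>j\<in>UNIV. \<forall>d\<in>?V - {0}.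
      mean ?V (\<lambda>x. mean ?V (\<lambda>y.
        \<Phi> j (X x) (X (xor x d)) (Y y) (Y (xor y d)) (Z (xor x y)) (Z (xor (xor x y) d))))
      \<le> mean6 C (\<Phi> j) + 3 * \<epsilon>"
    by (elim bexE)
  then have XYZ: "\<And>j d. d \<in> ?V - {0} \<Longrightarrow>
      mean ?V (\<lambda>x. mean ?V (\<lambda>y.
        \<Phi> j (X x) (X (xor x d)) (Y y) (Y (xor y d)) (Z (xor x y)) (Z (xor (xor x y) d))))
      \<le> mean6 C (\<Phi> j) + 3 * \<epsilon>"
    by simp
  define A where "A = {(x, y) \<in> ?V \<times> ?V. e (X x) (Y y) (Z (xor x y)) = 1}"
  let ?G = "xor_group n"
  have ord: "order ?G = 2 ^ n" by (simp add: order_def xor_group_def)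
  have bool_e: "of_bool (e a b c = 1) = e a b c" for a b c
    using e[of a b c] by auto
  have "pair_density ?G A = mean ?V (\<lambda>x. mean ?V (\<lambda>y. e (X x) (Y y) (Z (xor x y))))"
    unfolding pair_density_def ord A_def card_eq_mean bool_e by simp
  moreover have "1 - mean ?V (\<lambda>x. mean ?V (\<lambda>y. e (X x) (Y y) (Z (xor x y)))) \<le> 1 - p + 3 * \<epsilon>"
  proof -
    \<comment> \<open>This weight involves no shifted colours, so any nonzero \<open>d\<close> serves.\<close>
    have "1 < (2::nat) ^ n" using n(1) by (intro one_less_power) auto
    then have "1 \<in> ?V - {0}" by simp
    moreover have "?V \<noteq> {}" by (simp add: lessThan_empty_iff)
    ultimately show ?thesis
      using XYZ[of 1 False]
      unfolding \<Phi>_def if_False mean_diff mean_const[OF C] mean_const[OF finite_lessThan \<open>?V \<noteq> {}\<close>] p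
      by blast
  qed
  ultimately have dens: "pair_density ?G A \<ge> \<alpha>" using \<epsilon>(3) by linarith
  have few: "real (card (corner_set ?G A d)) \<le> (t + 3 * \<epsilon>) * (2 ^ n)\<^sup>2" if d: "d \<in> ?V - {0}" for d
  proof -
    have dl: "d < 2 ^ n" using d by simp
    have "corner_set ?G A d = {(x, y) \<in> ?V \<times> ?V. corner_weight e (X x) (X (xor x d)) (Y y)
        (Y (xor y d)) (Z (xor x y)) (Z (xor (xor x y) d)) = 1}"
    proof -
      have "corner_weight e a a' b b' c c' = 1 \<longleftrightarrow> e a b c = 1 \<and> e a' b c' = 1 \<and> e a b' c' = 1"
        for a a' b b' c c'
        using e[of a b c] e[of a' b c'] e[of a b' c'] by (auto simp: corner_weight_def)
      moreover have "xor (xor x d) y = xor (xor x y) d" "xor x (xor y d) = xor (xor x y) d" for x y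
        by (simp_all add: ac_simps)
      ultimately show ?thesis
        using dl by (auto simp: corner_set_def xor_group_def A_def xor_less)
    qed
    moreover have "of_bool (corner_weight e a a' b b' c c' = 1) = corner_weight e a a' b b' c c'"
      for a a' b b' c c'
      using e[of a b c] e[of a' b c'] e[of a b' c'] by (auto simp: corner_weight_def)
    ultimately have "real (card (corner_set ?G A d)) = (2 ^ n)\<^sup>2 * mean ?V (\<lambda>x. mean ?V (\<lambda>y.
        corner_weight e (X x) (X (xor x d)) (Y y) (Y (xor y d)) (Z (xor x y)) (Z (xor (xor x y) d))))"
      by (simp only: card_eq_mean)
    also have "\<dots> \<le> (2 ^ n)\<^sup>2 * (t + 3 * \<epsilon>)"
      using XYZ[OF d, of True] by (intro mult_left_mono) (simp_all add: \<Phi>_def t)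
    finally show ?thesis by (simp add: mult.commute)
  qed
  have "N \<le> order ?G" "A \<subseteq> carrier ?G \<times> carrier ?G"
    using n(2) ord by (simp, auto simp: A_def xor_group_def)
  from N[OF xor_group_in_finite_abelian_groups this dens]
  obtain d where d: "d \<in> carrier ?G - {\<one>\<^bsub>?G\<^esub>}"
    and many: "real (card (corner_set ?G A d)) > (M - (M - t) / 2) * real (order ?G) ^ 2"
    by (rule bexE)
  have "(t + 3 * \<epsilon>) * (2 ^ n)\<^sup>2 \<le> (M - (M - t) / 2) * (2 ^ n)\<^sup>2"
    using \<epsilon>(4) by (intro mult_right_mono) (auto simp: field_simps)
  moreover have "d \<in> ?V - {0}" using d by (simp add: xor_group_def)
  ultimately show False
    using few[of d] many unfolding ord of_nat_power of_nat_numeral by linarith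
qed

section \<open>The exponent\<close>

theorem mainTheorem5:
  fixes c \<alpha> :: real
  assumes "c = ln (26/27) / ln (3/4)"
    and "\<alpha> \<in> {0..1}"
  shows "threshold_density finite_abelian_groups \<alpha> \<le> 27/26 * \<alpha> powr (3 + c)"
proof (rule ccontr)
  let ?M = "threshold_density finite_abelian_groups \<alpha>"
  assume neg: "\<not> ?thesis"
  have M: "?M \<in> {0..1}" and pop: "popular_corner_bound finite_abelian_groups \<alpha> ?M"
    using threshold_density_greatest(1,2)[of finite_abelian_groups \<alpha>]
    by (auto simp: finite_abelian_groups_def comm_group_def)
  have ln34: "ln (3/4 :: real) < 0" by simp
  have c0: "0 < c"
    unfolding assms(1) by (intro divide_neg_neg) simp_all
  have pc: "(3/4) powr c = (26/27 :: real)"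
    using ln34 by (simp add: powr_def assms(1))
  consider "\<alpha> = 0" | "\<alpha> = 1" | "0 < \<alpha>" "\<alpha> < 1" using assms(2) by fastforce
  then show False
  proof cases
    case 1
    \<comment> \<open>High powers of one palette have positive density and arbitrarily few corners.\<close>
    then have "0 < ?M" using neg by simp
    then obtain k where "(26/64 :: real) ^ k < ?M"
      using real_arch_pow_inv[of ?M "26/64"] by auto
    then show False
      using not_popular_corner_bound_colour_model[OF colour_model_power[OF colour_model_not_all_equal]]
        1 pop by force
  next
    case 2
    then show False using neg M by simp
  next
    case 3
    have ex: "\<exists>k. (3/4 :: real) ^ k \<le> \<alpha>"
      using real_arch_pow_inv[of \<alpha> "3/4"] 3 by (auto intro: less_imp_le)
    \<comment> \<open>The position of \<open>\<alpha>\<close> between consecutive powers: \<open>(3/4) ^ Suc k \<le> \<alpha> < (3/4) ^ k\<close>.\<close>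
    define K where "K = (LEAST k. (3/4 :: real) ^ k \<le> \<alpha>)"
    have K: "(3/4) ^ K \<le> \<alpha>" unfolding K_def using ex by (rule LeastI_ex)
    with 3 have "K \<noteq> 0" by (metis not_less power_0)
    then obtain k where k: "K = Suc k" using not0_implies_Suc by blast
    then have lk: "\<alpha> < (3/4) ^ k"
      using not_less_Least[of k "\<lambda>k. (3/4 :: real) ^ k \<le> \<alpha>"] by (simp add: K_def)
    have "(26/27 :: real) ^ K = ((3/4) ^ K) powr c"
      by (simp add: pc[symmetric] powr_realpow[symmetric] powr_powr mult.commute)
    also have "\<dots> \<le> \<alpha> powr c"
      using K c0 by (intro powr_mono2) auto
    finally have pk: "(26/27 :: real) ^ k \<le> 27/26 * \<alpha> powr c" by (simp add: k)
    have "\<alpha> ^ 3 * (26/27) ^ k \<le> \<alpha> ^ 3 * (27/26 * \<alpha> powr c)"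
      using 3 pk by (intro mult_left_mono) auto
    also have "\<dots> = 27/26 * \<alpha> powr (3 + c)"
      using 3 by (simp add: powr_add)
    also have "\<dots> < ?M" using neg by simp
    finally have lim: "\<alpha> ^ 3 * (26/27) ^ k < ?M" .
    define \<beta> where "\<beta> = \<alpha> / (3/4) ^ k"
    have \<beta>: "0 < \<beta>" "\<beta> < 1" "\<alpha> = \<beta> * (3/4) ^ k" using 3 lk by (auto simp: \<beta>_def)
    have "(3/4 :: real) ^ 3 * (26/27) = 26/64" by (simp add: power3_eq_cube)
    then have "((3/4 :: real) ^ k) ^ 3 * (26/27) ^ k = (26/64) ^ k"
      by (metis power_mult power_mult_distrib mult.commute)
    then have lim': "\<beta> ^ 3 * (26/64) ^ k < ?M"
      using lim by (simp add: \<beta>(3) power_mult_distrib mult.assoc)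
    \<comment> \<open>A rational slightly above \<open>\<beta>\<close> keeps the corner count below the threshold and makes the density
      strictly larger than \<open>\<alpha>\<close>.\<close>
    have "((\<lambda>x. x ^ 3 * (26/64) ^ k) \<longlongrightarrow> \<beta> ^ 3 * (26/64) ^ k) (at_right \<beta>)"
      by (intro tendsto_intros)
    then have "eventually (\<lambda>x. x ^ 3 * (26/64) ^ k < ?M) (at_right \<beta>)"
      using lim' by (rule order_tendstoD(2))
    then obtain b where b: "\<beta> < b" "\<And>x. \<beta> < x \<Longrightarrow> x < b \<Longrightarrow> x ^ 3 * (26/64) ^ k < ?M"
      unfolding eventually_at_right_field by blast
    obtain q where q: "q \<in> \<rat>" "\<beta> < q" "q < min b 1"
      using Rats_dense_in_real[of \<beta> "min b 1"] b \<beta> by auto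
    obtain l m where lm: "q = real l / real m" "0 < m"
      using Rats_abs_nat_div_natE[OF q(1)] q(2) \<beta>(1) by (metis abs_of_pos less_trans not_gr0)
    have "l \<le> m" using q lm by (simp add: field_simps)
    have "colour_model (real l / real m * (3/4) ^ k) ((real l / real m) ^ 3 * (26/64) ^ k)"
      using lm \<open>l \<le> m\<close> by (intro colour_model_mult colour_model_mod colour_model_power colour_model_not_all_equal)
    moreover have "\<alpha> < real l / real m * (3/4) ^ k"
      unfolding \<beta>(3) using q(2) lm(1) by (intro mult_strict_right_mono) auto
    moreover have "(real l / real m) ^ 3 * (26/64) ^ k < ?M"
      using b(2)[of q] q lm by simp
    ultimately show False using not_popular_corner_bound_colour_model pop by blast
  qed
qed

end
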